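(* There is a countable GLP-space $(X,\tau_0,\tau_1,\dots)$ such that each topology $\tau_n$, $n<\omega$, is non-discrete.
   Context: For a topological space $(X,\tau)$ and $A\subseteq X$, $d_\tau(A)$ is the set of limit points of $A$: $x\in d_\tau(A)$ iff every open neighborhood of $x$ contains a point $y\ne x$ with $y\in A$. A space is scattered if every nonempty subspace has an isolated point. A polytopological space $(X,\tau_0,\tau_1,\dots)$ is a GLP-space if for each $n<\omega$: $\tau_n$ is scattered; $\tau_n\subseteq\tau_{n+1}$; and $d_{\tau_n}(A)$ is $\tau_{n+1}$-open for each $A\subseteq X$. *)

theory Defs
  imports "HOL-Analysis.Analysis"
begin

definition scattered_space :: "'a topology \<Rightarrow> bool" where
  "scattered_space T \<longleftrightarrow>
     (\<forall>S. S \<subseteq> topspace T \<and> S \<noteq> {} \<longrightarrow> (\<exists>x\<in>S. openin (subtopology T S) {x}))"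

definition GLP_space :: "'a set \<Rightarrow> (nat \<Rightarrow> 'a topology) \<Rightarrow> bool" where
  "GLP_space X \<tau> \<longleftrightarrow>
     (\<forall>n. topspace (\<tau> n) = X) \<and>
     (\<forall>n. scattered_space (\<tau> n)) \<and>
     (\<forall>n U. openin (\<tau> n) U \<longrightarrow> openin (\<tau> (Suc n)) U) \<and>
     (\<forall>n A. A \<subseteq> X \<longrightarrow> openin (\<tau> (Suc n)) ((\<tau> n) derived_set_of A))"

end

theory Submission
  imports Defs "HOL-Library.Countable_Set_Type"
begin

text \<open>
  Ranks of points live in a well-order, and \<open>lim_rank\<close> is the Cantor--Bendixson rank of a point of
  that order in its interval topology. Refine a scattered topology with rank function \<open>f\<close> as far as
  possible without changing \<open>f\<close>. Maximality forces every derived set to contain, near each of its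
  points \<open>x\<close>, all points of rank above some \<open>k < f x\<close>. Hence the topology in which these sets are the
  neighbourhoods of the points with \<open>lim_rank (f x) > 0\<close>, all other points being isolated, makes
  derived sets open, and it is again scattered, with rank function \<open>lim_rank \<circ> f\<close>. Iterating from the
  initial segment topology of a countable ordinal, no topology is discrete as long as the ordinal
  has, for every \<open>n\<close>, an element on which the \<open>n\<close>-th iterate of \<open>lim_rank\<close> is positive; below
  \<open>\<omega>\<^sub>1\<close> there are such elements because \<open>lim_rank\<close> takes every value cofinally often.
\<close>

section \<open>Ranks in a well-order\<close>

text \<open>The least rank that does not occur cofinally below \<open>r\<close>. In ordinal terms
  the value at a nonzero \<open>r\<close> is the last exponent of its Cantor normal form. The
  premise \<open>\<exists>k. k < r\<close> makes the condition vacuous at the least element, which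
  is thereby sent to itself.\<close>

function lim_rank :: "'a::wellorder \<Rightarrow> 'a" where
  "lim_rank r = (LEAST a. (\<exists>k. k < r) \<longrightarrow> (\<exists>k<r. a \<notin> lim_rank ` {k<..<r}))"
  by auto
termination by (relation "{(x, y). x < y}") (auto intro: wf)

declare lim_rank.simps [simp del]

lemma lim_rank_le: "lim_rank r \<le> r"
proof (induction r rule: less_induct)
  case (less r)
  have "(\<exists>k. k < r) \<longrightarrow> (\<exists>k<r. r \<notin> lim_rank ` {k<..<r})"
    using less by fastforce
  then show ?case
    by (subst lim_rank.simps) (rule Least_le)
qed

lemma lim_rank_avoids:
  assumes "k < r"
  shows "\<exists>k<r. lim_rank r \<notin> lim_rank ` {k<..<r}"
proof -
  let ?P = "\<lambda>a. (\<exists>k. k < r) \<longrightarrow> (\<exists>k<r. a \<notin> lim_rank ` {k<..<r})"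
  \<comment> \<open>\<open>LEAST\<close> needs a candidate: ranks of points below \<open>r\<close>
    do not exceed the points, so \<open>r\<close> itself is never among them.\<close>
  have "?P r"
  proof (intro impI exI conjI)
    show "r \<notin> lim_rank ` {k<..<r}"
      using lim_rank_le by (force simp: not_less[symmetric])
  qed (rule assms)
  then have "?P (LEAST a. ?P a)"
    by (rule LeastI)
  then show ?thesis
    using assms by (subst lim_rank.simps) blast
qed

lemma lim_rank_cofinal:
  assumes "a < lim_rank r" "k < r"
  shows "\<exists>s. k < s \<and> s < r \<and> lim_rank s = a"
proof -
  have "\<not> ((\<exists>k. k < r) \<longrightarrow> (\<exists>k<r. a \<notin> lim_rank ` {k<..<r}))"
    using assms(1) by (subst (asm) lim_rank.simps) (rule not_less_Least)
  then show ?thesis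
    using assms(2) by fastforce
qed

text \<open>Choose \<open>k\<close> so that the rank of \<open>r\<close> does not occur between
  \<open>k\<close> and \<open>r\<close>. A larger rank at some \<open>s\<close> in between would, by
  cofinality below \<open>s\<close>, produce the excluded rank between \<open>k\<close> and
  \<open>s\<close>.\<close>

lemma lim_rank_eventually_less:
  assumes "k < r"
  shows "\<exists>k<r. \<forall>s. k < s \<and> s < r \<longrightarrow> lim_rank s < lim_rank r"
proof -
  obtain k where k: "k < r" "lim_rank r \<notin> lim_rank ` {k<..<r}"
    using lim_rank_avoids[OF assms] by blast
  have "lim_rank s < lim_rank r" if s: "k < s" "s < r" for s
  proof (rule ccontr)
    assume "\<not> lim_rank s < lim_rank r"
    moreover have "lim_rank s \<noteq> lim_rank r"
      using k(2) s by (metis greaterThanLessThan_iff imageI)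
    ultimately have "lim_rank r < lim_rank s"
      by simp
    from lim_rank_cofinal[OF this s(1)] obtain t where "k < t" "t < s" "lim_rank t = lim_rank r"
      by blast
    with k(2) s(2) show False
      by (metis greaterThanLessThan_iff imageI less_trans)
  qed
  with k(1) show ?thesis
    by blast
qed

lemma lim_rank_pos_imp_pos:
  assumes "a < lim_rank r"
  shows "\<exists>k. k < r"
  using assms lim_rank_le[of r] by (blast intro: less_le_trans)

text \<open>Build a limit \<open>r\<close> above \<open>k\<close> below which every rank less than
  \<open>a\<close> occurs cofinally, so its rank is at least \<open>a\<close>. The rank of
  \<open>r\<close> need not be computed: if it exceeds \<open>a\<close>, cofinality gives a point of
  rank \<open>a\<close> between \<open>k\<close> and \<open>r\<close>.\<close>

lemma lim_rank_unbounded: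
  fixes a :: "'a::wellorder"
  assumes bounded: "\<And>A :: 'a set. countable A \<Longrightarrow> \<exists>b. \<forall>x\<in>A. x < b"
    and segments: "\<And>x :: 'a. countable {..<x}"
  shows "\<exists>r>k. lim_rank r = a"
proof (induction a arbitrary: k rule: less_induct)
  case (less a)
  \<comment> \<open>One witness above \<open>m\<close> for each \<open>b < a\<close> makes a
    countable set, so a single \<open>h\<close> bounds them all.\<close>
  have "\<exists>h>m. \<forall>b<a. \<exists>s. m < s \<and> s < h \<and> lim_rank s = b" for m
  proof -
    have "\<forall>b. \<exists>s. b < a \<longrightarrow> m < s \<and> lim_rank s = b"
      using less by blast
    from choice[OF this] obtain w where w: "\<And>b. b < a \<Longrightarrow> m < w b \<and> lim_rank (w b) = b"
      by blast
    obtain h where "\<forall>x\<in>insert m (w ` {..<a}). x < h"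
      using bounded[of "insert m (w ` {..<a})"] segments[of a] by auto
    with w show ?thesis
      by (intro exI[of _ h]) auto
  qed
  then have "\<forall>m. \<exists>h. m < h \<and> (\<forall>b<a. \<exists>s. m < s \<and> s < h \<and> lim_rank s = b)"
    by blast
  from choice[OF this] obtain h where h: "\<And>m. m < h m"
    "\<And>m b. b < a \<Longrightarrow> \<exists>s. m < s \<and> s < h m \<and> lim_rank s = b"
    by blast
  define g where "g n = (h ^^ n) k" for n
  have g_Suc: "g (Suc n) = h (g n)" for n
    by (simp add: g_def)
  \<comment> \<open>The supremum of the sequence \<open>g\<close>; by leastness every
    \<open>l < r\<close> is at most some \<open>g n\<close>, and the step from \<open>g n\<close> to
    \<open>g (Suc n)\<close> passes all ranks below \<open>a\<close>.\<close>
  define r where "r = (LEAST r. \<forall>n. g n < r)"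
  obtain b where "\<forall>x\<in>range g. x < b"
    using bounded[of "range g"] by auto
  then have g_less: "g n < r" for n
    unfolding r_def using LeastI[of "\<lambda>r. \<forall>n. g n < r" b] by auto
  have "k < r"
    using g_less[of 0] by (simp add: g_def)
  have hit: "\<exists>s. l < s \<and> s < r \<and> lim_rank s = b" if "l < r" "b < a" for l b
  proof -
    have "\<not> (\<forall>n. g n < l)"
      using not_less_Least[of l "\<lambda>r. \<forall>n. g n < r"] that(1) by (simp add: r_def)
    then obtain n where "l \<le> g n"
      by (meson not_less)
    then show ?thesis
      using h(2)[OF that(2), of "g n"] g_less[of "Suc n"] g_Suc[of n]
      by (metis le_less_trans less_trans)
  qed
  have "\<not> lim_rank r < a"
    using lim_rank_avoids[OF \<open>k < r\<close>] hit by (metis greaterThanLessThan_iff imageI)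
  then consider "lim_rank r = a" | "a < lim_rank r"
    by fastforce
  then show ?case
    using \<open>k < r\<close> lim_rank_cofinal[OF _ \<open>k < r\<close>] by cases blast+
qed

section \<open>Ranked topologies and their maximal refinements\<close>

text \<open>The first clause bounds the Cantor--Bendixson rank of \<open>x\<close> from above by
  \<open>f x\<close>, the second from below, so together they say that \<open>f\<close> is the rank
  function.\<close>

definition ranked :: "'b topology \<Rightarrow> ('b \<Rightarrow> 'a::wellorder) \<Rightarrow> bool" where
  "ranked T f \<longleftrightarrow>
     (\<forall>x\<in>topspace T. \<exists>U. openin T U \<and> x \<in> U \<and> (\<forall>y\<in>U - {x}. f y < f x)) \<and>
     (\<forall>U x a. openin T U \<and> x \<in> U \<and> a < f x \<longrightarrow> (\<exists>y\<in>U. f y = a))"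

definition max_ranked :: "'b topology \<Rightarrow> ('b \<Rightarrow> 'a::wellorder) \<Rightarrow> bool" where
  "max_ranked T f \<longleftrightarrow> ranked T f \<and>
     (\<forall>T'. topspace T' = topspace T \<and> ranked T' f \<and> (\<forall>U. openin T U \<longrightarrow> openin T' U) \<longrightarrow> T' = T)"

lemma rankedE:
  assumes "ranked T f" "x \<in> topspace T"
  obtains U where "openin T U" "x \<in> U" "\<And>y. y \<in> U \<Longrightarrow> y \<noteq> x \<Longrightarrow> f y < f x"
  using assms unfolding ranked_def by blast

lemma ranked_hits:
  assumes "ranked T f" "openin T U" "x \<in> U" "a < f x"
  shows "\<exists>y\<in>U. f y = a"
  using assms unfolding ranked_def by blast

text \<open>Neighbourhoods witnessing the first clause of \<open>ranked\<close> stay open in a finer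
  topology; only the second clause can be lost.\<close>

lemma ranked_refineI:
  assumes "ranked T f" "topspace T' = topspace T" "\<And>U. openin T U \<Longrightarrow> openin T' U"
    and "\<And>U x a. openin T' U \<Longrightarrow> x \<in> U \<Longrightarrow> a < f x \<Longrightarrow> \<exists>y\<in>U. f y = a"
  shows "ranked T' f"
  unfolding ranked_def
proof (intro conjI ballI allI impI)
  fix x assume "x \<in> topspace T'"
  with assms(1,2) obtain U where "openin T U" "x \<in> U" "\<And>y. y \<in> U \<Longrightarrow> y \<noteq> x \<Longrightarrow> f y < f x"
    by (auto elim: rankedE)
  with assms(3) show "\<exists>U. openin T' U \<and> x \<in> U \<and> (\<forall>y\<in>U - {x}. f y < f x)"
    by blast
qed (use assms(4) in blast)

text \<open>A point of least rank in \<open>S\<close> is isolated in \<open>S\<close>, since all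
  other points of a suitable neighbourhood have smaller rank.\<close>

lemma ranked_imp_scattered_space:
  assumes "ranked T f"
  shows "scattered_space T"
  unfolding scattered_space_def
proof (intro allI impI)
  fix S assume S: "S \<subseteq> topspace T \<and> S \<noteq> {}"
  then obtain z where "z \<in> S"
    by blast
  define m where "m = (LEAST a. a \<in> f ` S)"
  have "m \<in> f ` S"
    unfolding m_def using \<open>z \<in> S\<close> LeastI[of "\<lambda>a. a \<in> f ` S" "f z"] by blast
  then obtain x where x: "x \<in> S" "f x = m"
    by blast
  have min: "\<not> f y < f x" if "y \<in> S" for y
    using that not_less_Least[of "f y" "\<lambda>a. a \<in> f ` S"] unfolding x(2) m_def by blast
  obtain U where U: "openin T U" "x \<in> U" "\<And>y. y \<in> U \<Longrightarrow> y \<noteq> x \<Longrightarrow> f y < f x"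
    using rankedE[OF assms, of x] S x(1) by blast
  have "{x} = S \<inter> U"
    using U(2,3) min x(1) by blast
  then have "openin (subtopology T S) {x}"
    using U(1) by (auto simp: openin_subtopology_Int2)
  then show "\<exists>x\<in>S. openin (subtopology T S) {x}"
    using x(1) by blast
qed

text \<open>The open sets of all members of a chain form a base: of two members one is finer, and it
  contains the intersection. The resulting topology is the upper bound for Zorn's lemma.\<close>

lemma openin_chain_topology:
  fixes \<C> :: "'b topology set"
  assumes "\<And>T T'. T \<in> \<C> \<Longrightarrow> T' \<in> \<C> \<Longrightarrow>
    (\<forall>U. openin T U \<longrightarrow> openin T' U) \<or> (\<forall>U. openin T' U \<longrightarrow> openin T U)"
  shows "\<exists>T'. \<forall>U. openin T' U \<longleftrightarrow> (\<forall>x\<in>U. \<exists>T\<in>\<C>. \<exists>V. openin T V \<and> x \<in> V \<and> V \<subseteq> U)"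
proof -
  let ?P = "\<lambda>U. \<forall>x\<in>U. \<exists>T\<in>\<C>. \<exists>V. openin T V \<and> x \<in> V \<and> V \<subseteq> U"
  have "istopology ?P"
    unfolding istopology_def
  proof (intro conjI allI impI ballI)
    fix S S' x assume S: "?P S" and S': "?P S'" and x: "x \<in> S \<inter> S'"
    obtain T V where T: "T \<in> \<C>" "openin T V" "x \<in> V" "V \<subseteq> S"
      using S x by blast
    obtain T' V' where T': "T' \<in> \<C>" "openin T' V'" "x \<in> V'" "V' \<subseteq> S'"
      using S' x by blast
    have "openin T (V \<inter> V') \<or> openin T' (V \<inter> V')"
      using assms[OF T(1) T'(1)] T(2) T'(2) by blast
    then show "\<exists>T\<in>\<C>. \<exists>V. openin T V \<and> x \<in> V \<and> V \<subseteq> S \<inter> S'"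
      using T T' by (meson IntI Int_mono)
  next
    fix \<K> x assume K: "\<forall>K\<in>\<K>. ?P K" and "x \<in> \<Union>\<K>"
    then obtain K where "K \<in> \<K>" "x \<in> K"
      by blast
    with K obtain T V where "T \<in> \<C>" "openin T V" "x \<in> V" "V \<subseteq> K"
      by blast
    with \<open>K \<in> \<K>\<close> show "\<exists>T\<in>\<C>. \<exists>V. openin T V \<and> x \<in> V \<and> V \<subseteq> \<Union>\<K>"
      by blast
  qed
  then show ?thesis
    by (intro exI[of _ "topology ?P"] allI) simp
qed

text \<open>Zorn's lemma applies because a neighbourhood in the topology generated by a chain
  contains one from a single member, which already meets all smaller ranks.\<close>

lemma max_ranked_refinement_exists:
  fixes T :: "'b topology"
  assumes "ranked T f"
  shows "\<exists>T'. topspace T' = topspace T \<and> (\<forall>U. openin T U \<longrightarrow> openin T' U) \<and> max_ranked T' f"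
proof -
  define \<A> where "\<A> = {T'. topspace T' = topspace T \<and> (\<forall>U. openin T U \<longrightarrow> openin T' U) \<and> ranked T' f}"
  \<comment> \<open>Passing to families of open sets turns refinement into inclusion, the order of
    \<open>subset_Zorn\<close>.\<close>
  define opens :: "'b topology \<Rightarrow> 'b set set" where "opens T' = {U. openin T' U}" for T'
  have inj: "T1 = T2" if "opens T1 = opens T2" for T1 T2
    using that by (auto simp: opens_def topology_eq)
  have "T \<in> \<A>"
    using assms by (simp add: \<A>_def)
  have "\<exists>M\<in>opens ` \<A>. \<forall>\<U>\<in>opens ` \<A>. M \<subseteq> \<U> \<longrightarrow> \<U> = M"
  proof (rule subset_Zorn)
    fix \<D> assume \<D>: "subset.chain (opens ` \<A>) \<D>"
    show "\<exists>\<U>\<in>opens ` \<A>. \<forall>\<V>\<in>\<D>. \<V> \<subseteq> \<U>"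
    proof (cases "\<D> = {}")
      case True
      with \<open>T \<in> \<A>\<close> show ?thesis
        by blast
    next
      case False
      define \<C> where "\<C> = {T'. T' \<in> \<A> \<and> opens T' \<in> \<D>}"
      have \<D>_eq: "\<D> = opens ` \<C>"
        using \<D> by (auto simp: \<C>_def subset.chain_def)
      have "\<exists>T'. \<forall>U. openin T' U \<longleftrightarrow> (\<forall>x\<in>U. \<exists>T\<in>\<C>. \<exists>V. openin T V \<and> x \<in> V \<and> V \<subseteq> U)"
      proof (rule openin_chain_topology)
        fix T1 T2 assume "T1 \<in> \<C>" "T2 \<in> \<C>"
        then have "opens T1 \<subseteq> opens T2 \<or> opens T2 \<subseteq> opens T1"
          using \<D> by (auto simp: \<C>_def subset_chain_def)
        then show "(\<forall>U. openin T1 U \<longrightarrow> openin T2 U) \<or> (\<forall>U. openin T2 U \<longrightarrow> openin T1 U)"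
          by (auto simp: opens_def)
      qed
      then obtain T' where T':
        "\<And>U. openin T' U \<longleftrightarrow> (\<forall>x\<in>U. \<exists>T\<in>\<C>. \<exists>V. openin T V \<and> x \<in> V \<and> V \<subseteq> U)"
        by blast
      have finer: "openin T' U" if "T1 \<in> \<C>" "openin T1 U" for T1 U
        unfolding T' using that by blast
      obtain T0 where T0: "T0 \<in> \<C>"
        using False \<D>_eq by blast
      have T0\<A>: "topspace T0 = topspace T" "\<And>U. openin T U \<Longrightarrow> openin T0 U" "ranked T0 f"
        using T0 by (auto simp: \<C>_def \<A>_def)
      have top: "topspace T' = topspace T"
      proof
        show "topspace T' \<subseteq> topspace T"
        proof
          fix x assume "x \<in> topspace T'"
          then obtain T1 V where "T1 \<in> \<C>" "openin T1 V" "x \<in> V"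
            using T'[of "topspace T'"] by auto
          then show "x \<in> topspace T"
            using openin_subset by (fastforce simp: \<C>_def \<A>_def)
        qed
        show "topspace T \<subseteq> topspace T'"
          using openin_subset[OF finer[OF T0 openin_topspace]] T0\<A>(1) by simp
      qed
      have "ranked T' f"
      proof (rule ranked_refineI[OF T0\<A>(3)])
        show "topspace T' = topspace T0"
          using top T0\<A>(1) by simp
        show "openin T' U" if "openin T0 U" for U
          using finer T0 that by blast
        fix U x a assume "openin T' U" "x \<in> U" "a < f x"
        then obtain T1 V where V: "T1 \<in> \<C>" "openin T1 V" "x \<in> V" "V \<subseteq> U"
          unfolding T' by blast
        then have "ranked T1 f"
          by (simp add: \<C>_def \<A>_def)
        then show "\<exists>y\<in>U. f y = a"
          using ranked_hits[of T1 f V x a] V(2-4) \<open>a < f x\<close> by blast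
      qed
      then have "T' \<in> \<A>"
        using top finer[OF T0] T0\<A>(2) by (simp add: \<A>_def)
      moreover have "opens T1 \<subseteq> opens T'" if "T1 \<in> \<C>" for T1
        using finer[OF that] by (auto simp: opens_def)
      ultimately show ?thesis
        unfolding \<D>_eq by blast
    qed
  qed
  then obtain M where M: "M \<in> \<A>" "\<And>T'. T' \<in> \<A> \<Longrightarrow> opens M \<subseteq> opens T' \<Longrightarrow> opens T' = opens M"
    by blast
  have "max_ranked M f"
    unfolding max_ranked_def
  proof (intro conjI allI impI)
    show "ranked M f"
      using M(1) by (simp add: \<A>_def)
    fix T' assume T': "topspace T' = topspace M \<and> ranked T' f \<and> (\<forall>U. openin M U \<longrightarrow> openin T' U)"
    then have "T' \<in> \<A>"
      using M(1) by (simp add: \<A>_def)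
    then show "T' = M"
      using M(2) inj T' by (simp add: opens_def Collect_mono)
  qed
  then show ?thesis
    using M(1) by (auto simp: \<A>_def)
qed

section \<open>Consequences of maximality\<close>

text \<open>Adjoining \<open>insert x W\<close> to the open sets changes neighbourhoods only at
  \<open>x\<close>, where \<open>hits\<close> says that all smaller ranks are still met. The rank
  function survives, so by maximality the set was open already.\<close>

lemma max_ranked_openin_insert:
  assumes max: "max_ranked T f" and W: "openin T W" and x: "x \<in> topspace T"
    and hits: "\<And>U a. openin T U \<Longrightarrow> x \<in> U \<Longrightarrow> a < f x \<Longrightarrow> \<exists>y\<in>U \<inter> W. f y = a"
  shows "openin T (insert x W)"
proof -
  \<comment> \<open>The topology generated by \<open>T\<close> and \<open>insert x W\<close>. As
    \<open>W\<close> is open, new basic neighbourhoods are needed at \<open>x\<close> alone.\<close>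
  let ?P = "\<lambda>U. \<forall>y\<in>U. \<exists>V. openin T V \<and> y \<in> V \<and> (V \<subseteq> U \<or> y = x \<and> insert x (V \<inter> W) \<subseteq> U)"
  have "istopology ?P"
    unfolding istopology_def
  proof (intro conjI allI impI ballI)
    fix S S' y assume "?P S" "?P S'" "y \<in> S \<inter> S'"
    then obtain V V' where "openin T V" "y \<in> V" "V \<subseteq> S \<or> y = x \<and> insert x (V \<inter> W) \<subseteq> S"
      "openin T V'" "y \<in> V'" "V' \<subseteq> S' \<or> y = x \<and> insert x (V' \<inter> W) \<subseteq> S'"
      by (metis IntE)
    then show "\<exists>V. openin T V \<and> y \<in> V \<and> (V \<subseteq> S \<inter> S' \<or> y = x \<and> insert x (V \<inter> W) \<subseteq> S \<inter> S')"
      by (intro exI[of _ "V \<inter> V'"]) auto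
  next
    fix \<K> y assume K: "\<forall>K\<in>\<K>. ?P K" and "y \<in> \<Union>\<K>"
    then obtain K where "K \<in> \<K>" "y \<in> K"
      by blast
    with K obtain V where "openin T V" "y \<in> V" "V \<subseteq> K \<or> y = x \<and> insert x (V \<inter> W) \<subseteq> K"
      by blast
    with \<open>K \<in> \<K>\<close> show "\<exists>V. openin T V \<and> y \<in> V \<and> (V \<subseteq> \<Union>\<K> \<or> y = x \<and> insert x (V \<inter> W) \<subseteq> \<Union>\<K>)"
      by (intro exI[of _ V]) blast
  qed
  then have T': "openin (topology ?P) U \<longleftrightarrow> ?P U" for U
    by simp
  have finer: "openin (topology ?P) U" if "openin T U" for U
    unfolding T' using that by blast
  have top: "topspace (topology ?P) = topspace T"
  proof
    have "?P (topspace (topology ?P))"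
      using T'[of "topspace (topology ?P)"] openin_topspace by blast
    then show "topspace (topology ?P) \<subseteq> topspace T"
      using openin_subset by blast
    show "topspace T \<subseteq> topspace (topology ?P)"
      using finer[OF openin_topspace] by (rule openin_subset)
  qed
  have ranked: "ranked T f"
    using max by (simp add: max_ranked_def)
  have "ranked (topology ?P) f"
  proof (rule ranked_refineI[OF ranked top finer])
    fix U y a assume U: "openin (topology ?P) U" "y \<in> U" "a < f y"
    then obtain V where V: "openin T V" "y \<in> V" "V \<subseteq> U \<or> y = x \<and> insert x (V \<inter> W) \<subseteq> U"
      unfolding T' by blast
    from V(3) show "\<exists>y\<in>U. f y = a"
    proof
      assume "V \<subseteq> U"
      then show ?thesis
        using ranked_hits[OF ranked V(1,2) U(3)] by blast
    next
      assume "y = x \<and> insert x (V \<inter> W) \<subseteq> U"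
      then show ?thesis
        using hits[OF V(1)] V(2) U(3) by blast
    qed
  qed
  then have "topology ?P = T"
    using max top finer unfolding max_ranked_def by blast
  moreover have "openin (topology ?P) (insert x W)"
    unfolding T' using W x by (metis insert_iff openin_topspace Int_lower2 insert_mono subset_insertI)
  ultimately show ?thesis
    by simp
qed

text \<open>By maximality the complement \<open>W\<close> of the closure of \<open>A\<close> omits some rank \<open>k < f x\<close> near \<open>x\<close>; it
  then omits all higher ranks too, so points of rank above \<open>k\<close> are limits of the closure of \<open>A\<close>.\<close>

lemma max_ranked_derived_set:
  assumes max: "max_ranked T f" and x: "x \<in> T derived_set_of A"
  shows "\<exists>V k. openin T V \<and> x \<in> V \<and> k < f x \<and> (\<forall>y\<in>V. k < f y \<longrightarrow> y \<in> T derived_set_of A)"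
proof -
  have ranked: "ranked T f"
    using max by (simp add: max_ranked_def)
  define W where "W = topspace T - T closure_of A"
  have W: "openin T W"
    by (simp add: W_def openin_diff)
  have xT: "x \<in> topspace T"
    using x by (simp add: in_derived_set_of)
  have "A \<inter> W = {}"
    using closure_of_subset_Int[of T A] by (auto simp: W_def)
  \<comment> \<open>Otherwise it would be a neighbourhood of the limit point \<open>x\<close> with
    no point of \<open>A\<close> other than possibly \<open>x\<close>.\<close>
  then have "\<not> openin T (insert x W)"
    using x unfolding in_derived_set_of by blast
  then obtain U k where U: "openin T U" "x \<in> U" "k < f x" and avoid: "\<And>y. y \<in> U \<inter> W \<Longrightarrow> f y \<noteq> k"
    using max_ranked_openin_insert[OF max W xT] by blast
  have "y \<in> T derived_set_of A" if y: "y \<in> U" "k < f y" for y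
    unfolding in_derived_set_of
  proof (intro conjI allI impI)
    show "y \<in> topspace T"
      using U(1) y(1) openin_subset by blast
    fix N assume N: "y \<in> N \<and> openin T N"
    then have NU: "openin T (N \<inter> U)"
      using U(1) by blast
    obtain z where z: "z \<in> N \<inter> U" "f z = k"
      using ranked_hits[OF ranked NU _ y(2)] N y(1) by blast
    then have zT: "z \<in> topspace T"
      using NU openin_subset by blast
    \<comment> \<open>\<open>O'\<close> caps the ranks at \<open>k\<close>, so the point of
      \<open>A\<close> found near \<open>z\<close> has smaller rank than \<open>y\<close> and
      differs from it.\<close>
    obtain O' where O': "openin T O'" "z \<in> O'" "\<And>w. w \<in> O' \<Longrightarrow> w \<noteq> z \<Longrightarrow> f w < f z"
      using rankedE[OF ranked zT] by blast
    have "z \<in> T closure_of A"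
      using avoid z zT by (auto simp: W_def)
    moreover have "openin T (N \<inter> U \<inter> O')"
      using NU O'(1) by blast
    moreover have "z \<in> N \<inter> U \<inter> O'"
      using z(1) O'(2) by blast
    ultimately obtain w where w: "w \<in> A" "w \<in> N \<inter> U \<inter> O'"
      unfolding in_closure_of by meson
    then have "f w \<le> k"
      using O'(3)[of w] z(2) by force
    then have "w \<noteq> y"
      using y(2) by auto
    then show "\<exists>w. w \<noteq> y \<and> w \<in> A \<and> w \<in> N"
      using w by blast
  qed
  with U show ?thesis
    by blast
qed

section \<open>Making derived sets open\<close>

text \<open>The guard \<open>\<exists>a. a < lim_rank (f x)\<close> expresses positivity in a bare
  well-order. It exempts the points whose rank is least or a successor; at the least rank no
  \<open>k < f x\<close> exists.\<close>

definition next_topology :: "'b topology \<Rightarrow> ('b \<Rightarrow> 'a::wellorder) \<Rightarrow> 'b topology" where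
  "next_topology T f = topology (\<lambda>U. U \<subseteq> topspace T \<and>
     (\<forall>x\<in>U. (\<exists>a. a < lim_rank (f x)) \<longrightarrow>
        (\<exists>V k. openin T V \<and> x \<in> V \<and> k < f x \<and> (\<forall>y\<in>V. k < f y \<longrightarrow> y \<in> U))))"

lemma openin_next_topology:
  "openin (next_topology T f) U \<longleftrightarrow> U \<subseteq> topspace T \<and>
     (\<forall>x\<in>U. (\<exists>a. a < lim_rank (f x)) \<longrightarrow>
        (\<exists>V k. openin T V \<and> x \<in> V \<and> k < f x \<and> (\<forall>y\<in>V. k < f y \<longrightarrow> y \<in> U)))"
proof -
  define Q where "Q U x \<longleftrightarrow> ((\<exists>a. a < lim_rank (f x)) \<longrightarrow>
    (\<exists>V k. openin T V \<and> x \<in> V \<and> k < f x \<and> (\<forall>y\<in>V. k < f y \<longrightarrow> y \<in> U)))" for U x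
  have Int: "Q (S \<inter> S') x" if "Q S x" "Q S' x" for S S' x
    unfolding Q_def
  proof
    assume "\<exists>a. a < lim_rank (f x)"
    then obtain V k V' k' where "openin T V" "x \<in> V" "k < f x" "\<forall>y\<in>V. k < f y \<longrightarrow> y \<in> S"
      "openin T V'" "x \<in> V'" "k' < f x" "\<forall>y\<in>V'. k' < f y \<longrightarrow> y \<in> S'"
      using \<open>Q S x\<close> \<open>Q S' x\<close> unfolding Q_def by blast
    then show "\<exists>V k. openin T V \<and> x \<in> V \<and> k < f x \<and> (\<forall>y\<in>V. k < f y \<longrightarrow> y \<in> S \<inter> S')"
      by (intro exI[of _ "V \<inter> V'"] exI[of _ "max k k'"]) auto
  qed
  have mono: "Q S' x" if "Q S x" "S \<subseteq> S'" for S S' x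
    using that unfolding Q_def by blast
  have "istopology (\<lambda>U. U \<subseteq> topspace T \<and> (\<forall>x\<in>U. Q U x))"
    unfolding istopology_def
  proof (rule conjI; intro allI impI)
    fix S S' assume "S \<subseteq> topspace T \<and> (\<forall>x\<in>S. Q S x)" "S' \<subseteq> topspace T \<and> (\<forall>x\<in>S'. Q S' x)"
    then show "S \<inter> S' \<subseteq> topspace T \<and> (\<forall>x\<in>S \<inter> S'. Q (S \<inter> S') x)"
      using Int by blast
  next
    fix \<K> assume "\<forall>K\<in>\<K>. K \<subseteq> topspace T \<and> (\<forall>x\<in>K. Q K x)"
    then show "\<Union>\<K> \<subseteq> topspace T \<and> (\<forall>x\<in>\<Union>\<K>. Q (\<Union>\<K>) x)"
      using mono[OF _ Union_upper] by blast
  qed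
  then show ?thesis
    unfolding next_topology_def Q_def by simp
qed

lemma openin_imp_openin_next_topology:
  assumes "openin T U"
  shows "openin (next_topology T f) U"
  unfolding openin_next_topology
proof (intro conjI ballI impI)
  show "U \<subseteq> topspace T"
    using assms by (rule openin_subset)
  fix x assume "x \<in> U" "\<exists>a. a < lim_rank (f x)"
  moreover from this obtain k where "k < f x"
    using lim_rank_pos_imp_pos by blast
  ultimately show "\<exists>V k. openin T V \<and> x \<in> V \<and> k < f x \<and> (\<forall>y\<in>V. k < f y \<longrightarrow> y \<in> U)"
    using assms by blast
qed

lemma topspace_next_topology [simp]: "topspace (next_topology T f) = topspace T"
proof
  show "topspace (next_topology T f) \<subseteq> topspace T"
    using openin_topspace[of "next_topology T f"] unfolding openin_next_topology by blast
  show "topspace T \<subseteq> topspace (next_topology T f)"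
    using openin_imp_openin_next_topology[OF openin_topspace] by (rule openin_subset)
qed

text \<open>Near \<open>x\<close> a new neighbourhood contains the old points with rank between some
  \<open>k\<close> and \<open>f x\<close>. For \<open>k\<close> large enough their
  \<open>lim_rank\<close> stays below that of \<open>f x\<close>, and for every \<open>k\<close> it
  takes all smaller values.\<close>

lemma ranked_next_topology:
  assumes "ranked T f"
  shows "ranked (next_topology T f) (lim_rank \<circ> f)"
  unfolding ranked_def
proof (intro conjI ballI allI impI)
  fix x assume "x \<in> topspace (next_topology T f)"
  then have x: "x \<in> topspace T"
    by simp
  show "\<exists>U. openin (next_topology T f) U \<and> x \<in> U \<and> (\<forall>y\<in>U - {x}. (lim_rank \<circ> f) y < (lim_rank \<circ> f) x)"
  proof (cases "\<exists>a. a < lim_rank (f x)")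
    case False
    then have "openin (next_topology T f) {x}"
      using x by (simp add: openin_next_topology)
    then show ?thesis
      by blast
  next
    case True
    then obtain l where "l < f x"
      using lim_rank_pos_imp_pos by blast
    from lim_rank_eventually_less[OF this]
    obtain k where k: "k < f x" "\<And>s. k < s \<Longrightarrow> s < f x \<Longrightarrow> lim_rank s < lim_rank (f x)"
      by blast
    obtain V where V: "openin T V" "x \<in> V" "\<And>y. y \<in> V \<Longrightarrow> y \<noteq> x \<Longrightarrow> f y < f x"
      using rankedE[OF assms x] by blast
    \<comment> \<open>The same \<open>V\<close> and \<open>k\<close> serve as witnesses at every
      point of this set.\<close>
    have "openin (next_topology T f) {y \<in> V. k < f y}"
      unfolding openin_next_topology using openin_subset[OF V(1)] V(1) by blast
    moreover have "x \<in> {y \<in> V. k < f y}"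
      using V(2) k(1) by simp
    moreover have "\<forall>y\<in>{y \<in> V. k < f y} - {x}. (lim_rank \<circ> f) y < (lim_rank \<circ> f) x"
      using V(3) k(2) by simp
    ultimately show ?thesis
      by blast
  qed
next
  fix U x a assume U: "openin (next_topology T f) U \<and> x \<in> U \<and> a < (lim_rank \<circ> f) x"
  then obtain V k where V: "openin T V" "x \<in> V" "k < f x" "\<And>y. y \<in> V \<Longrightarrow> k < f y \<Longrightarrow> y \<in> U"
    unfolding openin_next_topology comp_def by metis
  obtain s where s: "k < s" "s < f x" "lim_rank s = a"
    using lim_rank_cofinal[of a "f x" k] U V(3) by auto
  obtain y where "y \<in> V" "f y = s"
    using ranked_hits[OF assms V(1,2) s(2)] by blast
  with V(4) s show "\<exists>y\<in>U. (lim_rank \<circ> f) y = a"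
    by auto
qed

lemma openin_next_topology_derived_set:
  assumes "max_ranked T f"
  shows "openin (next_topology T f) (T derived_set_of A)"
  unfolding openin_next_topology
  by (intro conjI ballI impI max_ranked_derived_set[OF assms] derived_set_of_subset_topspace)

section \<open>Iteration of the construction\<close>

text \<open>Alternate the two constructions: each \<open>\<tau> n\<close> is maximal for its rank
  function, and \<open>\<tau> (Suc n)\<close> is a maximal refinement of its next topology. Refining
  keeps the derived sets open.\<close>

lemma GLP_space_of_ranked:
  assumes "ranked T f"
  shows "\<exists>\<tau>. GLP_space (topspace T) \<tau> \<and> (\<forall>n. ranked (\<tau> n) (lim_rank ^^ n \<circ> f))"
proof -
  define P where "P n T' \<longleftrightarrow> topspace T' = topspace T \<and> max_ranked T' (lim_rank ^^ n \<circ> f)" for n T'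
  \<comment> \<open>This relation between consecutive levels yields both that the topologies
    increase and that derived sets become open.\<close>
  define Q where "Q n T1 T2 \<longleftrightarrow>
    (\<forall>U. openin (next_topology T1 (lim_rank ^^ n \<circ> f)) U \<longrightarrow> openin T2 U)" for n T1 T2
  have "\<exists>\<tau>. \<forall>n. P n (\<tau> n) \<and> Q n (\<tau> n) (\<tau> (Suc n))"
  proof (rule dependent_nat_choice)
    show "\<exists>T'. P 0 T'"
      using max_ranked_refinement_exists[OF assms] by (auto simp: P_def id_def comp_def)
  next
    fix T1 n assume "P n T1"
    then have T1: "topspace T1 = topspace T" "ranked T1 (lim_rank ^^ n \<circ> f)"
      by (auto simp: P_def max_ranked_def)
    have "ranked (next_topology T1 (lim_rank ^^ n \<circ> f)) (lim_rank ^^ Suc n \<circ> f)"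
      using ranked_next_topology[OF T1(2)] by (simp add: comp_assoc)
    from max_ranked_refinement_exists[OF this] T1(1)
    show "\<exists>T2. P (Suc n) T2 \<and> Q n T1 T2"
      by (auto simp: P_def Q_def)
  qed
  then obtain \<tau> where \<tau>: "\<And>n. P n (\<tau> n)" "\<And>n. Q n (\<tau> n) (\<tau> (Suc n))"
    by blast
  have top: "topspace (\<tau> n) = topspace T" and max: "max_ranked (\<tau> n) (lim_rank ^^ n \<circ> f)" for n
    using \<tau>(1)[of n] by (auto simp: P_def)
  have ranked: "ranked (\<tau> n) (lim_rank ^^ n \<circ> f)" for n
    using max[of n] by (simp add: max_ranked_def)
  have "GLP_space (topspace T) \<tau>"
    unfolding GLP_space_def
  proof (intro conjI allI impI)
    show "topspace (\<tau> n) = topspace T" for n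
      by (rule top)
    show "scattered_space (\<tau> n)" for n
      using ranked by (rule ranked_imp_scattered_space)
    show "openin (\<tau> (Suc n)) U" if "openin (\<tau> n) U" for n U
      using \<tau>(2) openin_imp_openin_next_topology[OF that] unfolding Q_def by blast
    show "openin (\<tau> (Suc n)) (\<tau> n derived_set_of A)" for n A
      using \<tau>(2) openin_next_topology_derived_set[OF max] unfolding Q_def by blast
  qed
  with ranked show ?thesis
    by blast
qed

text \<open>Take the downward closed sets as open. Injectivity of \<open>f\<close> makes the other
  ranks in the least neighbourhood of a point strictly smaller, and surjectivity onto an initial
  segment provides every smaller rank.\<close>

lemma initial_segment_topology:
  fixes f :: "'b \<Rightarrow> 'a::wellorder"
  assumes "bij_betw f X {..<\<beta>}"
  shows "\<exists>T. topspace T = X \<and> ranked T f"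
proof -
  let ?P = "\<lambda>U. U \<subseteq> X \<and> (\<forall>x\<in>U. \<forall>y\<in>X. f y < f x \<longrightarrow> y \<in> U)"
  have "istopology ?P"
    unfolding istopology_def by blast
  then have T: "openin (topology ?P) U \<longleftrightarrow> ?P U" for U
    by simp
  have top: "topspace (topology ?P) = X"
    using T[of X] T[of "topspace (topology ?P)"] openin_subset[of "topology ?P" X] by auto
  have "ranked (topology ?P) f"
    unfolding ranked_def top
  proof (intro conjI ballI allI impI)
    fix x assume x: "x \<in> X"
    have "openin (topology ?P) {y \<in> X. f y \<le> f x}"
      unfolding T by auto
    moreover have "\<forall>y\<in>{y \<in> X. f y \<le> f x} - {x}. f y < f x"
      using assms x by (auto simp: bij_betw_def dest: inj_onD intro: le_neq_trans)
    ultimately show "\<exists>U. openin (topology ?P) U \<and> x \<in> U \<and> (\<forall>y\<in>U - {x}. f y < f x)"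
      using x by blast
  next
    fix U x a assume U: "openin (topology ?P) U \<and> x \<in> U \<and> a < f x"
    then have "x \<in> X"
      unfolding T by blast
    then have "a \<in> f ` X"
      using assms U less_trans by (fastforce simp: bij_betw_def)
    then show "\<exists>y\<in>U. f y = a"
      using U unfolding T by blast
  qed
  with top show ?thesis
    by blast
qed

section \<open>The first uncountable ordinal\<close>

text \<open>The successor cardinal of \<open>natLeq\<close> is a well-order of type \<omega>1. As a
  type it can be an instance of \<open>wellorder\<close>, where \<open>lim_rank\<close>
  lives.\<close>

typedef omega1 = "Field (cardSuc natLeq)"
  using Field_cardSuc_not_empty[OF natLeq_Card_order] by blast

instantiation omega1 :: wellorder
begin

definition less_eq_omega1 :: "omega1 \<Rightarrow> omega1 \<Rightarrow> bool" where
  "x \<le> y \<longleftrightarrow> (Rep_omega1 x, Rep_omega1 y) \<in> cardSuc natLeq"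

definition less_omega1 :: "omega1 \<Rightarrow> omega1 \<Rightarrow> bool" where
  "less_omega1 x y \<longleftrightarrow> x \<le> y \<and> x \<noteq> y"

instance
proof
  have wo: "Well_order (cardSuc natLeq)"
    using cardSuc_Card_order[OF natLeq_Card_order] by (simp add: card_order_on_def)
  then have refl: "refl_on (Field (cardSuc natLeq)) (cardSuc natLeq)"
    and trans: "trans (cardSuc natLeq)" and antisym: "antisym (cardSuc natLeq)"
    and total: "total_on (Field (cardSuc natLeq)) (cardSuc natLeq)"
    and wf: "wf (cardSuc natLeq - Id)"
    by (simp_all add: order_on_defs)
  fix x y z :: omega1
  show le_refl: "x \<le> x" for x :: omega1
    using refl Rep_omega1 by (simp add: less_eq_omega1_def refl_on_def)
  show "x \<le> y \<Longrightarrow> y \<le> z \<Longrightarrow> x \<le> z"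
    using trans unfolding less_eq_omega1_def by (rule transD)
  show le_antisym: "x \<le> y \<Longrightarrow> y \<le> x \<Longrightarrow> x = y" for x y :: omega1
    using antisym unfolding less_eq_omega1_def by (metis Rep_omega1_inject antisymD)
  show "x < y \<longleftrightarrow> x \<le> y \<and> \<not> y \<le> x"
    unfolding less_omega1_def using le_refl le_antisym by blast
  show "x \<le> y \<or> y \<le> x"
    using total Rep_omega1 le_refl unfolding less_eq_omega1_def total_on_def
    by (metis Rep_omega1_inject)
  fix P :: "omega1 \<Rightarrow> bool" and a
  assume step: "\<And>x. (\<And>y. y < x \<Longrightarrow> P y) \<Longrightarrow> P x"
  have "{(x, y). x < y} \<subseteq> inv_image (cardSuc natLeq - Id) Rep_omega1"
    by (auto simp: less_omega1_def less_eq_omega1_def Rep_omega1_inject)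
  then have "wf {(x, y :: omega1). x < y}"
    using wf by (blast intro: wf_subset wf_inv_image)
  then show "P a"
    by (rule wf_induct_rule) (use step in blast)
qed

end

text \<open>Proper initial segments of a cardinal order have smaller cardinality, and below the
  successor of \<aleph>0 this means countable.\<close>

lemma countable_lessThan_omega1:
  includes cardinal_syntax
  shows "countable {..<x :: omega1}"
proof -
  have "|underS (cardSuc natLeq) (Rep_omega1 x)| <o cardSuc natLeq"
    using card_of_underS[OF cardSuc_Card_order[OF natLeq_Card_order] Rep_omega1] .
  then have "|underS (cardSuc natLeq) (Rep_omega1 x)| \<le>o natLeq"
    using cardSuc_ordLeq_ordLess[OF natLeq_Card_order card_of_Card_order] by (rule iffD1[rotated])
  then have "countable (underS (cardSuc natLeq) (Rep_omega1 x))"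
    by (simp add: countable_card_le_natLeq)
  moreover have "Rep_omega1 ` {..<x} \<subseteq> underS (cardSuc natLeq) (Rep_omega1 x)"
    by (auto simp: underS_def less_omega1_def less_eq_omega1_def Rep_omega1_inject)
  ultimately have "countable (Rep_omega1 ` {..<x})"
    by (rule countable_subset[rotated])
  then show ?thesis
    by (rule countable_image_inj_on) (auto simp: inj_on_def Rep_omega1_inject)
qed

lemma uncountable_UNIV_omega1:
  includes cardinal_syntax
  shows "uncountable (UNIV :: omega1 set)"
proof
  assume "countable (UNIV :: omega1 set)"
  then have "countable (Field (cardSuc natLeq))"
    using type_definition.Rep_range[OF type_definition_omega1] by (metis countable_image)
  then have "|Field (cardSuc natLeq)| \<le>o natLeq"
    by (simp add: countable_card_le_natLeq)
  then have "cardSuc natLeq \<le>o natLeq"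
    by (rule ordIso_ordLeq_trans[OF
          ordIso_symmetric[OF card_of_Field_ordIso[OF cardSuc_Card_order[OF natLeq_Card_order]]]])
  then show False
    using not_ordLess_ordLeq[OF cardSuc_greater[OF natLeq_Card_order]] by contradiction
qed

text \<open>An unbounded countable set would cover the type by countably many countable initial
  segments.\<close>

lemma countable_bounded_omega1:
  fixes A :: "omega1 set"
  assumes "countable A"
  shows "\<exists>b. \<forall>x\<in>A. x < b"
proof (rule ccontr)
  assume "\<not> ?thesis"
  then have "UNIV = (\<Union>x\<in>A. insert x {..<x})"
    by (force simp: not_less le_less)
  moreover have "countable (\<Union>x\<in>A. insert x {..<x})"
    using assms countable_lessThan_omega1 by simp
  ultimately show False
    using uncountable_UNIV_omega1 by simp
qed

text \<open>Surjectivity passes to iterates, which gives points of positive rank at every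
  level.\<close>

lemma surj_lim_rank_omega1: "surj (lim_rank :: omega1 \<Rightarrow> omega1)"
  using lim_rank_unbounded[OF countable_bounded_omega1 countable_lessThan_omega1] by (metis surjI)

section \<open>The countable example\<close>

theorem theorem5p6:
  shows "\<exists>(X :: nat set) (\<tau> :: nat \<Rightarrow> nat topology).
           countable X \<and> GLP_space X \<tau> \<and> (\<forall>n. \<tau> n \<noteq> discrete_topology X)"
proof -
  \<comment> \<open>Any non-least \<open>c\<close> will do as the rank to be realised at every
    level; \<open>a\<close> witnesses that it is positive.\<close>
  obtain a c :: omega1 where "a < c"
    using countable_bounded_omega1[of "{undefined}"] by blast
  have "\<exists>r. (lim_rank ^^ n) r = c" for n
    using surj_fn[OF surj_lim_rank_omega1, of n] by (metis surjD)
  then obtain r where r: "\<And>n. (lim_rank ^^ n) (r n) = c"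
    by metis
  \<comment> \<open>Countably many levels need only countably many ordinals \<open>r n\<close>, so a
    countable initial segment contains them all.\<close>
  obtain \<beta> where \<beta>: "\<And>n. r n < \<beta>"
    using countable_bounded_omega1[of "range r"] by auto
  \<comment> \<open>Points are natural numbers coding the ordinals below \<open>\<beta>\<close>;
    \<open>f\<close> decodes them.\<close>
  define X where "X = to_nat_on {..<\<beta>} ` {..<\<beta>}"
  define f where "f = from_nat_into {..<\<beta>}"
  have f: "bij_betw f X {..<\<beta>}"
    unfolding X_def f_def using countable_lessThan_omega1[of \<beta>]
    by (intro bij_betw_byWitness[where f' = "to_nat_on {..<\<beta>}"]) auto
  obtain T where "topspace T = X" "ranked T f"
    using initial_segment_topology[OF f] by blast
  then obtain \<tau> where \<tau>: "GLP_space X \<tau>" "\<And>n. ranked (\<tau> n) (lim_rank ^^ n \<circ> f)"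
    using GLP_space_of_ranked by blast
  have "\<tau> n \<noteq> discrete_topology X" for n
  proof
    assume discrete: "\<tau> n = discrete_topology X"
    have "r n \<in> f ` X"
      using f \<beta> by (simp add: bij_betw_def)
    then obtain x where x: "x \<in> X" "f x = r n"
      by auto
    then have "openin (\<tau> n) {x}"
      by (simp add: discrete)
    \<comment> \<open>An open set around a point of rank \<open>c\<close> must contain a point of
      rank \<open>a\<close>, but \<open>{x}\<close> has only rank \<open>c\<close>.\<close>
    then have "\<exists>y\<in>{x}. (lim_rank ^^ n \<circ> f) y = a"
      using ranked_hits[OF \<tau>(2)] x r \<open>a < c\<close> by force
    then show False
      using x r \<open>a < c\<close> by simp
  qed
  with \<tau>(1) show ?thesis
    by (metis countableI_type)
qed

end
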